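(* Let $r\ge 3$ and $k\ge 3$ be integers and let $G$ be an $r$-uniform hypergraph on $n$ vertices that is $\mathcal{G}_k^{(r)}$-free. Let $F\in\mathcal{M}_2$ with $|F|\ge k+1$. Then $|F|\ge 2m(F)-k+3$.
   Context: An $r$-graph is identified with its edge set; $|H|$ is its number of edges and $V(H)=\bigcup_{e\in H}e$. The family $\mathcal{G}_k^{(r)}$ consists of all $r$-graphs $H$ such that either $|H|=k$ and $|V(H)|\le (r-2)k+2$, or $|H|=\ell$ and $|V(H)|\le (r-2)\ell+1$ for some $\ell\in\{2,\dots,k-1\}$; $G$ is $\mathcal{G}_k^{(r)}$-free if no subset of its edges forms a member of this family. For $F\subseteq G$ and distinct vertices $x,y$, let $C_F(xy)$ be the set of integers $i\ge 0$ for which there exist $i$ distinct edges $e_1,\dots,e_i\in F$ with $|\{x,y\}\cup e_1\cup\dots\cup e_i|\le (r-2)i+2$. An $r$-graph $F$ is connected if for any edges $X,Y\in F$ there are edges $X=X_1,\dots,X_m=Y$ of $F$ with $|X_i\cap X_{i+1}|\ge 2$ for all $i$. $\mathcal{M}_1$ is the partition of $E(G)$ into maximal connected subgraphs (1-clusters). Edge-disjoint $F,H\subseteq G$ are $1|2$-mergeable if there is a pair $xy$ with $1\in C_F(xy)$ and $2\in C_H(xy)$, or with $2\in C_F(xy)$ and $1\in C_H(xy)$. $\mathcal{M}_2$ is a partition of $E(G)$ obtained from $\mathcal{M}_1$ by repeatedly replacing two distinct $1|2$-mergeable parts by their union as long as possible. For $F\in\mathcal{M}_2$, the merging number $m(F)$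 is the number of 1-clusters (elements of $\mathcal{M}_1$) contained in $F$. *)

theory Defs
  imports Main
begin

text \<open>A hypergraph is identified with its edge set, of type \<open>'a set set\<close>.\<close>

definition vertices :: "'a set set \<Rightarrow> 'a set" where
  "vertices H = \<Union> H"

definition r_graph :: "nat \<Rightarrow> 'a set set \<Rightarrow> bool" where
  "r_graph r H \<longleftrightarrow> finite H \<and> (\<forall>e\<in>H. finite e \<and> card e = r)"

definition r_graph_on :: "nat \<Rightarrow> 'a set \<Rightarrow> 'a set set \<Rightarrow> bool" where
  "r_graph_on r V G \<longleftrightarrow> finite V \<and> r_graph r G \<and> vertices G \<subseteq> V"

text \<open>All numerical bounds below are over \<open>nat\<close>; \<open>r - 2\<close> is the true difference for \<open>r \<ge> 2\<close>.\<close>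

definition family_G :: "nat \<Rightarrow> nat \<Rightarrow> 'a set set set" where
  "family_G r k = {H. r_graph r H \<and>
     ((card H = k \<and> card (vertices H) \<le> (r - 2) * k + 2) \<or>
      (\<exists>l\<in>{2..k - 1}. card H = l \<and> card (vertices H) \<le> (r - 2) * l + 1))}"

definition G_free :: "nat \<Rightarrow> nat \<Rightarrow> 'a set set \<Rightarrow> bool" where
  "G_free r k G \<longleftrightarrow> (\<forall>H. H \<subseteq> G \<longrightarrow> H \<notin> family_G r k)"

definition C_set :: "nat \<Rightarrow> 'a set set \<Rightarrow> 'a \<Rightarrow> 'a \<Rightarrow> nat set" where
  "C_set r F x y = {i. \<exists>S\<subseteq>F. finite S \<and> card S = i \<and>
      card ({x, y} \<union> \<Union> S) \<le> (r - 2) * i + 2}"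

definition connected_graph :: "'a set set \<Rightarrow> bool" where
  "connected_graph F \<longleftrightarrow> (\<forall>X\<in>F. \<forall>Y\<in>F. \<exists>Xs. Xs \<noteq> [] \<and> set Xs \<subseteq> F \<and>
      hd Xs = X \<and> last Xs = Y \<and> successively (\<lambda>A B. card (A \<inter> B) \<ge> 2) Xs)"

text \<open>The partition \<open>\<M>\<^sub>1\<close>. The condition \<open>F \<noteq> {}\<close> only matters for the empty
  graph, whose partition has no parts.\<close>

definition one_clusters :: "'a set set \<Rightarrow> 'a set set set" where
  "one_clusters G = {F. F \<subseteq> G \<and> F \<noteq> {} \<and> connected_graph F \<and>
     (\<forall>F'. F \<subseteq> F' \<and> F' \<subseteq> G \<and> connected_graph F' \<longrightarrow> F' = F)}"

text \<open>The pair \<open>x, y\<close> need not be restricted to vertices of the hypergraph: in an \<open>r\<close>-graph with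
  \<open>r \<ge> 2\<close>, \<open>1 \<in> C_set r F x y\<close> already says that some edge of \<open>F\<close> contains both.\<close>

definition mergeable_1_2 :: "nat \<Rightarrow> 'a set set \<Rightarrow> 'a set set \<Rightarrow> bool" where
  "mergeable_1_2 r F H \<longleftrightarrow> F \<inter> H = {} \<and>
     (\<exists>x y. x \<noteq> y \<and>
        ((1 \<in> C_set r F x y \<and> 2 \<in> C_set r H x y) \<or>
         (2 \<in> C_set r F x y \<and> 1 \<in> C_set r H x y)))"

definition merge_step :: "nat \<Rightarrow> 'a set set set \<Rightarrow> 'a set set set \<Rightarrow> bool" where
  "merge_step r P Q \<longleftrightarrow> (\<exists>A\<in>P. \<exists>B\<in>P. A \<noteq> B \<and> mergeable_1_2 r A B \<and>
      Q = insert (A \<union> B) (P - {A, B}))"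

text \<open>Whether \<open>P\<close> is a possible \<open>\<M>\<^sub>2\<close>, that is, the outcome of some run of the
  merging process; runs are not assumed to lead to a unique outcome.\<close>

definition is_M2 :: "nat \<Rightarrow> 'a set set \<Rightarrow> 'a set set set \<Rightarrow> bool" where
  "is_M2 r G P \<longleftrightarrow> (merge_step r)\<^sup>*\<^sup>* (one_clusters G) P \<and> (\<nexists>Q. merge_step r P Q)"

definition merging_number :: "'a set set \<Rightarrow> 'a set set \<Rightarrow> nat" where
  "merging_number G F = card {H \<in> one_clusters G. H \<subseteq> F}"

end

theory Submission
  imports Defs
begin

text \<open>
  Call a triple of edges \<open>f, g, h\<close> linked if \<open>g\<close> and \<open>h\<close> share two vertices and \<open>f\<close> shares two
  vertices with \<open>g \<union> h\<close>. Parts of \<open>\<M>\<^sub>2\<close> are connected with respect to linked triples, so inside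
  such a part \<open>F\<close> a set \<open>S\<close> of edges spanning at most \<open>(r - 2) |S| + 2\<close> vertices can always be
  enlarged, keeping this bound, by one edge \<open>f\<close> or by two edges \<open>g, h\<close> at once. Size \<open>k\<close> is
  forbidden, so the enlargement gets stuck at a set \<open>X\<close> of size \<open>k - 1\<close> to which only pairs can be
  added, and \<open>X\<close> meets at most \<open>k - 2\<close> clusters. From then on only pairs are ever added: if after
  a pair \<open>g, h\<close> linked to \<open>f \<in> X\<close> a single edge became available, then enlarging \<open>{f}\<close> inside \<open>X\<close>
  to size \<open>k - 3\<close> or \<open>k - 2\<close> and continuing with \<open>g, h\<close> and this edge would hit size \<open>k\<close>. Each
  pair lies in one cluster, so \<open>|X|\<close> minus twice the number of clusters met never decreases.
\<close>

section \<open>Connectedness by linked triples\<close>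

text \<open>The case \<open>g = h\<close> is included on purpose: for finite \<open>g\<close> it
  means that \<open>f\<close> and \<open>g\<close> share two vertices. Thus one relation covers both
  adjacency inside a 1-cluster and a merge.\<close>

definition linked :: "'a set \<Rightarrow> 'a set \<Rightarrow> 'a set \<Rightarrow> bool" where
  "linked f g h \<longleftrightarrow> 2 \<le> card (g \<inter> h) \<and> 2 \<le> card (f \<inter> (g \<union> h))"

text \<open>Connectedness is stated by cuts instead of walks, since growing a set only asks for a
  triple that crosses its boundary.\<close>

definition link_connected :: "'a set set \<Rightarrow> bool" where
  "link_connected X \<longleftrightarrow> (\<forall>S. S \<subset> X \<and> S \<noteq> {} \<longrightarrow>
     (\<exists>f g h. {f, g, h} \<subseteq> X \<and> linked f g h \<and> \<not> {f, g, h} \<subseteq> S \<and> {f, g, h} \<inter> S \<noteq> {}))"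

text \<open>Having only the first entry new is general enough: if exactly one of \<open>g\<close>,
  \<open>h\<close> is new, it shares two vertices with the other and is itself the first entry of a
  triple with a repeated entry.\<close>

definition link_closed :: "'a set set \<Rightarrow> 'a set set \<Rightarrow> bool" where
  "link_closed F X \<longleftrightarrow> (\<forall>f\<in>F - X. \<forall>g\<in>X. \<forall>h\<in>X. \<not> linked f g h)"

text \<open>The bound of the size-\<open>k\<close> members of the forbidden family, kept in the same
  form for all sizes.\<close>

definition tight :: "nat \<Rightarrow> 'a set set \<Rightarrow> bool" where
  "tight r S \<longleftrightarrow> finite S \<and> card (\<Union> S) \<le> (r - 2) * card S + 2"

text \<open>Serves as a label of the edge \<open>e\<close>: for \<open>X\<close> inside
  \<open>G\<close>, the size of the image of \<open>X\<close> counts the 1-clusters that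
  \<open>X\<close> meets.\<close>

definition cluster_of :: "'a set set \<Rightarrow> 'a set \<Rightarrow> 'a set set" where
  "cluster_of G e = {f. (\<lambda>A B. A \<in> G \<and> B \<in> G \<and> 2 \<le> card (A \<inter> B))\<^sup>*\<^sup>* e f}"

lemma ex_maximal_subset:
  assumes "finite F" "P A" "\<And>X. P X \<Longrightarrow> X \<subseteq> F"
  shows "\<exists>X. P X \<and> (\<forall>Y. P Y \<longrightarrow> X \<subseteq> Y \<longrightarrow> Y = X)"
proof -
  have "finite {X. P X}" using assms by (auto intro: finite_subset[of _ "Pow F"])
  from finite_has_maximal[OF this] assms(2) show ?thesis by auto
qed

lemma linked_sameI: "2 \<le> card (f \<inter> g) \<Longrightarrow> finite g \<Longrightarrow> linked f g g"
  unfolding linked_def by (metis Int_absorb Int_lower2 Un_absorb card_mono le_trans)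

lemma link_connected_singleton: "link_connected {e}"
  unfolding link_connected_def by blast

text \<open>A cut of the union either splits \<open>X\<close> or \<open>Y\<close>, or is one of them
  and misses the other. In the last case the given triple crosses it.\<close>

lemma link_connected_Un:
  assumes X: "link_connected X" and Y: "link_connected Y"
    and l: "linked f g h" "{f, g, h} \<subseteq> X \<union> Y" "{f, g, h} \<inter> X \<noteq> {}" "{f, g, h} \<inter> Y \<noteq> {}"
  shows "link_connected (X \<union> Y)"
  unfolding link_connected_def
proof (intro allI impI, elim conjE)
  fix S assume S: "S \<subset> X \<union> Y" "S \<noteq> {}"
  have cross: "\<exists>f g h. {f, g, h} \<subseteq> X \<union> Y \<and> linked f g h \<and> \<not> {f, g, h} \<subseteq> S \<and> {f, g, h} \<inter> S \<noteq> {}"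
    if Z: "link_connected Z" "Z \<subseteq> X \<union> Y" "S \<inter> Z \<noteq> {}" "\<not> Z \<subseteq> S" for Z
  proof -
    have "S \<inter> Z \<subset> Z" using Z by blast
    then obtain f g h where "{f, g, h} \<subseteq> Z" "linked f g h" "\<not> {f, g, h} \<subseteq> S \<inter> Z"
        "{f, g, h} \<inter> (S \<inter> Z) \<noteq> {}"
      using Z unfolding link_connected_def by metis
    note fgh = this
    show ?thesis
      by (rule exI[of _ f], rule exI[of _ g], rule exI[of _ h]) (use Z fgh in blast)
  qed
  consider "S \<inter> X \<noteq> {}" "\<not> X \<subseteq> S" | "S \<inter> Y \<noteq> {}" "\<not> Y \<subseteq> S"
    | "S = X" "S \<inter> Y = {}" | "S = Y" "S \<inter> X = {}"
    using S by blast
  then show "\<exists>f g h. {f, g, h} \<subseteq> X \<union> Y \<and> linked f g h \<and> \<not> {f, g, h} \<subseteq> S \<and> {f, g, h} \<inter> S \<noteq> {}"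
  proof cases
    case 1 then show ?thesis by (intro cross[OF X]) auto
  next
    case 2 then show ?thesis by (intro cross[OF Y]) auto
  next
    case 3 show ?thesis
      by (rule exI[of _ f], rule exI[of _ g], rule exI[of _ h]) (use l S 3 in blast)
  next
    case 4 show ?thesis
      by (rule exI[of _ f], rule exI[of _ g], rule exI[of _ h]) (use l S 4 in blast)
  qed
qed

lemma link_connected_insert:
  assumes "link_connected X" "linked f g h" "g \<in> X" "h \<in> X"
  shows "link_connected (insert f X)"
  using link_connected_Un[OF assms(1) link_connected_singleton[of f] assms(2)] assms(3,4) by simp

lemma link_connected_insert2:
  assumes "link_connected X" "linked f g h" "f \<in> X" "finite g" "finite h"
  shows "link_connected (insert g (insert h X))"
proof -
  have "linked g h h" using assms(2,5) linked_sameI[of g h] by (simp add: linked_def)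
  then have "link_connected {g, h}"
    using link_connected_insert[OF link_connected_singleton[of h]] by blast
  then show ?thesis
    using link_connected_Un[OF assms(1) _ assms(2), of "{g, h}"] assms(3) by simp
qed

text \<open>Take a triple crossing the cut \<open>S\<close>. If \<open>S\<close> separates
  \<open>g\<close> from \<open>h\<close>, the outer one can be added alone because they share two
  vertices; if both are inside, \<open>f\<close> is outside; if both are outside, \<open>f\<close>
  is inside, and \<open>g = h\<close> falls back to a single edge.\<close>

lemma link_connected_step [consumes 4, case_names one two]:
  assumes X: "link_connected X" "\<forall>e\<in>X. finite e" and S: "S \<subset> X" "S \<noteq> {}"
  obtains (one) f g h where "f \<in> X - S" "g \<in> S" "h \<in> S" "linked f g h"
  | (two) f g h where "f \<in> S" "g \<in> X - S" "h \<in> X - S" "g \<noteq> h" "linked f g h"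
proof -
  obtain f g h where l: "{f, g, h} \<subseteq> X" "linked f g h" "\<not> {f, g, h} \<subseteq> S" "{f, g, h} \<inter> S \<noteq> {}"
    using X S unfolding link_connected_def by metis
  have fin: "finite f" "finite g" "finite h" using l X by auto
  have gh: "linked g h h" "linked h g g"
    using l(2) fin linked_sameI[of g h] linked_sameI[of h g] by (auto simp: linked_def Int_commute)
  show thesis
  proof (cases "g \<in> S \<longleftrightarrow> h \<in> S")
    case False
    then consider "g \<in> X - S" "h \<in> S" | "h \<in> X - S" "g \<in> S" using l(1) by blast
    then show ?thesis using gh one by cases
  next
    case True
    show ?thesis
    proof (cases "g \<in> S")
      case True': True
      then show ?thesis using True one[of f g h] l by simp
    next
      case False
      then have f: "f \<in> S" using True l by auto
      have "linked g f f" if "g = h"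
        using l(2) fin that linked_sameI[of g f] by (auto simp: linked_def Int_commute)
      then show ?thesis using one[of g f f] two[of f g h] f False True l by (cases "g = h") auto
    qed
  qed
qed

section \<open>Growth of tight sets\<close>

text \<open>At least two vertices of \<open>f\<close> are old, so at most \<open>r - 2\<close> are
  new.\<close>

lemma tight_insert:
  assumes "tight r S" "linked f g h" "g \<in> S" "h \<in> S" "f \<notin> S"
    "card f = r" "r \<ge> 2" "\<forall>e\<in>S. finite e" "finite f"
  shows "tight r (insert f S)"
proof -
  have fin: "finite S" "finite (\<Union>S)" using assms by (auto simp: tight_def)
  have "2 \<le> card (f \<inter> (g \<union> h))" using assms by (simp add: linked_def)
  also have "\<dots> \<le> card (f \<inter> \<Union>S)" using fin assms by (intro card_mono) auto
  finally have "card (f \<union> \<Union>S) + 2 \<le> r + card (\<Union>S)"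
    using card_Un_Int[of f "\<Union>S"] fin assms by simp
  moreover have "card (\<Union>S) \<le> (r - 2) * card S + 2" using assms by (simp add: tight_def)
  ultimately show ?thesis using fin assms by (simp add: tight_def)
qed

text \<open>The union of \<open>g\<close> and \<open>h\<close> has at most \<open>2 * r - 2\<close>
  vertices, and two of them lie in \<open>f\<close>, so at most \<open>2 * (r - 2)\<close> are
  new.\<close>

lemma tight_insert2:
  assumes "tight r S" "linked f g h" "f \<in> S" "g \<notin> S" "h \<notin> S" "g \<noteq> h"
    "card g = r" "card h = r" "r \<ge> 2" "\<forall>e\<in>S. finite e" "finite g" "finite h"
  shows "tight r (insert g (insert h S))"
proof -
  have fin: "finite S" "finite (\<Union>S)" using assms by (auto simp: tight_def)
  have "2 \<le> card (f \<inter> (g \<union> h))" using assms by (simp add: linked_def)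
  also have "\<dots> \<le> card ((g \<union> h) \<inter> \<Union>S)" using fin assms by (intro card_mono) auto
  finally have "card ((g \<union> h) \<union> \<Union>S) + 2 \<le> card (g \<union> h) + card (\<Union>S)"
    using card_Un_Int[of "g \<union> h" "\<Union>S"] fin assms by simp
  moreover have "card (g \<union> h) + 2 \<le> 2 * r"
    using card_Un_Int[of g h] assms by (simp add: linked_def)
  moreover have "card (\<Union>S) \<le> (r - 2) * card S + 2" using assms by (simp add: tight_def)
  ultimately show ?thesis using fin assms by (simp add: tight_def Un_assoc)
qed

lemma G_free_not_tight:
  assumes "G_free r k G" "r_graph r G" "S \<subseteq> G" "tight r S"
  shows "card S \<noteq> k"
proof
  assume "card S = k"
  then have "S \<in> family_G r k"
    using assms by (auto simp: family_G_def r_graph_def tight_def vertices_def)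
  then show False using assms by (simp add: G_free_def)
qed

text \<open>Growing \<open>{f}\<close> inside \<open>X\<close> by one or two edges at a time cannot
  skip two consecutive sizes.\<close>

lemma tight_subset_of_size:
  assumes X: "link_connected X" "r_graph r X" and "r \<ge> 2" "f \<in> X" "t \<le> card X"
  obtains S where "tight r S" "f \<in> S" "S \<subseteq> X" "card S = t \<or> card S = t + 1"
proof -
  have X': "finite X" "\<forall>e\<in>X. finite e" "\<forall>e\<in>X. card e = r" using X by (auto simp: r_graph_def)
  have "\<exists>S. tight r S \<and> f \<in> S \<and> S \<subseteq> X \<and> (card S = t \<or> card S = t + 1)"
    using \<open>t \<le> card X\<close>
  proof (induction t)
    case 0
    show ?case using assms X' by (intro exI[of _ "{f}"]) (auto simp: tight_def)
  next
    case (Suc t)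
    then have "t \<le> card X" by simp
    with Suc.IH obtain S where S: "tight r S" "f \<in> S" "S \<subseteq> X" "card S = t \<or> card S = t + 1"
      by blast
    show ?case
    proof (cases "card S = t + 1")
      case True
      \<comment> \<open>Overshooting \<open>t\<close> by one is an exact hit for
        \<open>Suc t\<close>, so nothing has to be added.\<close>
      then show ?thesis using S by (intro exI[of _ S]) simp
    next
      case False
      then have cS: "card S = t" using S by auto
      have finS: "finite S" "\<forall>e\<in>S. finite e" using S X' finite_subset by auto
      have "S \<subset> X" "S \<noteq> {}" using cS Suc.prems S by auto
      with X(1) X'(2) show ?thesis
      proof (cases rule: link_connected_step)
        case (one f' g h)
        then have "tight r (insert f' S)"
          using S X' finS assms by (intro tight_insert[of r S f' g h]) auto
        then show ?thesis using S one cS finS by (intro exI[of _ "insert f' S"]) auto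
      next
        case (two f' g h)
        then have "tight r (insert g (insert h S))"
          using S X' finS assms by (intro tight_insert2[of r S f' g h]) auto
        then show ?thesis using S two cS finS by (intro exI[of _ "insert g (insert h S)"]) auto
      qed
    qed
  qed
  then show thesis using that by blast
qed

section \<open>1-clusters as classes of edges\<close>

text \<open>A walk from \<open>S\<close> to its complement leaves \<open>S\<close> in some step from
  \<open>a\<close> to \<open>b\<close>; then \<open>a\<close>, \<open>b\<close>, \<open>b\<close> is
  a linked triple crossing the cut.\<close>

lemma connected_graph_link_connected:
  assumes "connected_graph F" "\<forall>e\<in>F. finite e"
  shows "link_connected F"
  unfolding link_connected_def
proof (intro allI impI, elim conjE)
  fix S assume S: "S \<subset> F" "S \<noteq> {}"
  have walk: "\<exists>a\<in>S. \<exists>b\<in>F - S. 2 \<le> card (a \<inter> b)"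
    if "Xs \<noteq> []" "set Xs \<subseteq> F" "hd Xs \<in> S" "last Xs \<notin> S"
      "successively (\<lambda>A B. card (A \<inter> B) \<ge> 2) Xs" for Xs
    using that
  proof (induction Xs)
    case (Cons a Xs)
    then show ?case by (cases Xs) (auto split: if_splits)
  qed simp
  obtain X Y where XY: "X \<in> S" "Y \<in> F - S" using S by blast
  then have "X \<in> F" "Y \<in> F" using S by auto
  then obtain Xs where "Xs \<noteq> []" "set Xs \<subseteq> F" "hd Xs = X" "last Xs = Y"
      "successively (\<lambda>A B. card (A \<inter> B) \<ge> 2) Xs"
    using assms(1)[unfolded connected_graph_def, rule_format, of X Y] by auto
  with XY obtain a b where ab: "a \<in> S" "b \<in> F - S" "2 \<le> card (a \<inter> b)"
    using walk[of Xs] by auto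
  then have abb: "linked a b b" using assms(2) linked_sameI by blast
  show "\<exists>f g h. {f, g, h} \<subseteq> F \<and> linked f g h \<and> \<not> {f, g, h} \<subseteq> S \<and> {f, g, h} \<inter> S \<noteq> {}"
    by (rule exI[of _ a], rule exI[of _ b], rule exI[of _ b]) (use ab abb S in auto)
qed

lemma cluster_of_eq:
  assumes "e \<in> G" "f \<in> G" "2 \<le> card (e \<inter> f)"
  shows "cluster_of G e = cluster_of G f"
proof -
  have *: "cluster_of G e \<subseteq> cluster_of G f" if "e \<in> G" "f \<in> G" "2 \<le> card (e \<inter> f)" for e f
    using that unfolding cluster_of_def
    by (auto intro: converse_rtranclp_into_rtranclp simp: Int_commute)
  show ?thesis using *[of e f] *[of f e] assms by (simp add: Int_commute)
qed

lemma connected_graph_cluster_of: "connected_graph (cluster_of G e)"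
proof -
  let ?R = "\<lambda>A B. A \<in> G \<and> B \<in> G \<and> 2 \<le> card (A \<inter> B)"
  let ?N = "\<lambda>A B. card (A \<inter> B) \<ge> 2"
  have walk: "\<exists>Xs. Xs \<noteq> [] \<and> set Xs \<subseteq> cluster_of G e \<and> hd Xs = X \<and> last Xs = Y \<and> successively ?N Xs"
    if "?R\<^sup>*\<^sup>* X Y" "X \<in> cluster_of G e" for X Y
    using that
  proof (induction rule: converse_rtranclp_induct)
    case base
    then show ?case by (intro exI[of _ "[Y]"]) auto
  next
    case (step X Z)
    then have "Z \<in> cluster_of G e" unfolding cluster_of_def by (auto intro: rtranclp.rtrancl_into_rtrancl)
    then obtain Xs where "Xs \<noteq> []" "set Xs \<subseteq> cluster_of G e" "hd Xs = Z" "last Xs = Y"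
        "successively ?N Xs"
      using step by blast
    then show ?case using step by (intro exI[of _ "X # Xs"]) (auto simp: successively_Cons)
  qed
  have sym: "?R\<^sup>*\<^sup>* X e" if "?R\<^sup>*\<^sup>* e X" for X
    using that
  proof (induction rule: rtranclp_induct)
    case (step y z)
    then have "?R z y" by (simp add: Int_commute)
    then show ?case using step.IH by (rule converse_rtranclp_into_rtranclp)
  qed simp
  show ?thesis unfolding connected_graph_def
  proof (intro ballI walk)
    fix X Y assume "X \<in> cluster_of G e" "Y \<in> cluster_of G e"
    then show "?R\<^sup>*\<^sup>* X Y" using sym[of X] unfolding cluster_of_def by auto
  qed
qed

text \<open>Walks in \<open>H\<close> stay in the class of \<open>e\<close>, and this class is
  itself a connected subgraph of \<open>G\<close>, so maximality of \<open>H\<close> forces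
  equality.\<close>

lemma one_cluster_eq_cluster_of:
  assumes H: "H \<in> one_clusters G" and e: "e \<in> H"
  shows "H = cluster_of G e"
proof -
  let ?R = "\<lambda>A B. A \<in> G \<and> B \<in> G \<and> 2 \<le> card (A \<inter> B)"
  have HG: "H \<subseteq> G" "connected_graph H" using H by (auto simp: one_clusters_def)
  have walk: "?R\<^sup>*\<^sup>* (hd Xs) (last Xs)"
    if "Xs \<noteq> []" "set Xs \<subseteq> G" "successively (\<lambda>A B. card (A \<inter> B) \<ge> 2) Xs" for Xs
    using that
  proof (induction Xs)
    case (Cons a Xs)
    then show ?case
      by (cases Xs) (auto intro: converse_rtranclp_into_rtranclp)
  qed simp
  have "H \<subseteq> cluster_of G e"
  proof
    fix f assume "f \<in> H"
    with e obtain Xs where "Xs \<noteq> []" "set Xs \<subseteq> H" "hd Xs = e" "last Xs = f"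
        "successively (\<lambda>A B. card (A \<inter> B) \<ge> 2) Xs"
      using HG(2)[unfolded connected_graph_def, rule_format, of e f] by auto
    then show "f \<in> cluster_of G e" using walk[of Xs] HG by (auto simp: cluster_of_def)
  qed
  moreover have "cluster_of G e \<subseteq> G"
  proof
    fix f assume "f \<in> cluster_of G e"
    then have "?R\<^sup>*\<^sup>* e f" by (simp add: cluster_of_def)
    then show "f \<in> G" using e HG by (induction rule: rtranclp_induct) auto
  qed
  ultimately show ?thesis
    using H connected_graph_cluster_of[of G e] by (auto simp: one_clusters_def)
qed

text \<open>A 1-cluster is nonempty, hence it is the class of any of its edges.\<close>

lemma merging_number_le:
  assumes "finite F"
  shows "merging_number G F \<le> card (cluster_of G ` F)"
  unfolding merging_number_def
proof (rule card_mono)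
  show "{H \<in> one_clusters G. H \<subseteq> F} \<subseteq> cluster_of G ` F"
  proof
    fix H assume H: "H \<in> {H \<in> one_clusters G. H \<subseteq> F}"
    then obtain e where "e \<in> H" by (auto simp: one_clusters_def)
    then show "H \<in> cluster_of G ` F" using H one_cluster_eq_cluster_of by blast
  qed
qed (use assms in simp)

section \<open>Link-connectedness of merged parts\<close>

text \<open>Freeness for two edges, available as \<open>k \<ge> 3\<close>, leaves \<open>g\<close>
  and \<open>h\<close> at least \<open>2 * r - 2\<close> vertices, which is also the upper bound
  from \<open>C2\<close>. So \<open>x\<close>, \<open>y\<close> lie in their union, and
  \<open>g\<close>, \<open>h\<close> share two vertices.\<close>

lemma C_set_1_2_linked:
  assumes free: "G_free r k G" "k \<ge> 3" and G: "r_graph r G" "r \<ge> 2" and FH: "F \<subseteq> G" "H \<subseteq> G"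
    and "x \<noteq> y" and C1: "1 \<in> C_set r F x y" and C2: "2 \<in> C_set r H x y"
  obtains f g h where "f \<in> F" "g \<in> H" "h \<in> H" "linked f g h"
proof -
  obtain f where f: "f \<in> F" "card ({x, y} \<union> f) \<le> r"
    using C1 \<open>r \<ge> 2\<close> unfolding C_set_def by (auto simp: card_1_singleton_iff)
  obtain S where S: "S \<subseteq> H" "card S = 2" "card ({x, y} \<union> \<Union>S) \<le> (r - 2) * 2 + 2"
    using C2 unfolding C_set_def by auto
  then obtain g h where gh: "S = {g, h}" "g \<noteq> h" by (auto simp: card_2_iff)
  have mem: "f \<in> G" "g \<in> G" "h \<in> G" using f S gh FH by auto
  then have fin: "finite f" "finite g" "finite h" and r: "card f = r" "card g = r" "card h = r"
    using G by (auto simp: r_graph_def)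
  \<comment> \<open>Adding \<open>x\<close> and \<open>y\<close> leaves at most \<open>r\<close>
    vertices, and \<open>f\<close> already has \<open>r\<close>.\<close>
  have "f = {x, y} \<union> f" using f fin r by (intro card_seteq) auto
  then have xyf: "{x, y} \<subseteq> f" by blast
  have "S \<notin> family_G r k" using free mem gh by (simp add: G_free_def)
  moreover have "r_graph r S" using mem gh G by (simp add: r_graph_def)
  ultimately have big: "\<not> card (g \<union> h) \<le> (r - 2) * 2 + 1"
    using free(2) S(2) gh by (auto simp: family_G_def vertices_def)
  then have "g \<union> h = {x, y} \<union> (g \<union> h)" using S(3) gh fin by (intro card_seteq) auto
  then have "{x, y} \<subseteq> f \<inter> (g \<union> h)" using xyf by blast
  then have "card {x, y} \<le> card (f \<inter> (g \<union> h))" using fin by (intro card_mono) auto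
  then have "2 \<le> card (f \<inter> (g \<union> h))" using \<open>x \<noteq> y\<close> by simp
  moreover have "card (g \<union> h) \<le> card ({x, y} \<union> (g \<union> h))" using fin by (intro card_mono) auto
  then have "2 \<le> card (g \<inter> h)" using card_Un_Int[OF fin(2,3)] S(3) gh r \<open>r \<ge> 2\<close> by simp
  ultimately show thesis using that[of f g h] f S gh by (auto simp: linked_def)
qed

text \<open>An invariant of the merging process: 1-clusters have the property, and each merge
  supplies a linked triple meeting both parts.\<close>

lemma is_M2_link_connected:
  assumes free: "G_free r k G" "k \<ge> 3" and G: "r_graph r G" "r \<ge> 2"
    and "is_M2 r G P" "F \<in> P"
  shows "F \<subseteq> G" "link_connected F"
proof -
  have fin: "\<forall>e\<in>G. finite e" using G by (auto simp: r_graph_def)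
  have "(merge_step r)\<^sup>*\<^sup>* (one_clusters G) P" using assms by (simp add: is_M2_def)
  then have "\<forall>F\<in>P. F \<subseteq> G \<and> link_connected F"
  proof (induction rule: rtranclp_induct)
    case base
    show ?case
    proof
      fix F assume "F \<in> one_clusters G"
      then have "F \<subseteq> G" "connected_graph F" by (auto simp: one_clusters_def)
      then show "F \<subseteq> G \<and> link_connected F" using connected_graph_link_connected fin by blast
    qed
  next
    case (step P Q)
    then obtain A B where AB: "A \<in> P" "B \<in> P" "mergeable_1_2 r A B"
        "Q = insert (A \<union> B) (P - {A, B})"
      unfolding merge_step_def by blast
    then have con: "A \<subseteq> G" "B \<subseteq> G" "link_connected A" "link_connected B" using step by auto
    have "link_connected (A \<union> B)"
    proof -
      obtain x y where xy: "x \<noteq> y" "(1 \<in> C_set r A x y \<and> 2 \<in> C_set r B x y) \<or>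
         (2 \<in> C_set r A x y \<and> 1 \<in> C_set r B x y)"
        using AB(3) unfolding mergeable_1_2_def by blast
      from xy(2) show ?thesis
      proof (elim disjE conjE)
        assume "1 \<in> C_set r A x y" "2 \<in> C_set r B x y"
        with C_set_1_2_linked[OF free G con(1,2) xy(1)] obtain f g h
          where "f \<in> A" "g \<in> B" "h \<in> B" "linked f g h" by metis
        then show ?thesis using link_connected_Un[OF con(3,4)] by blast
      next
        assume "2 \<in> C_set r A x y" "1 \<in> C_set r B x y"
        with C_set_1_2_linked[OF free G con(2,1) xy(1)] obtain f g h
          where "f \<in> B" "g \<in> A" "h \<in> A" "linked f g h" by metis
        then show ?thesis using link_connected_Un[OF con(3,4)] by blast
      qed
    qed
    then show ?case using AB con step by auto
  qed
  then show "F \<subseteq> G" "link_connected F" using \<open>F \<in> P\<close> by auto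
qed

section \<open>Sets that grow only by pairs\<close>

text \<open>Take a maximal tight link-connected set of size at most \<open>k - 1\<close>. A single
  new edge would again give size at most \<open>k - 1\<close>, as \<open>k\<close> is forbidden,
  against maximality. A pair must therefore be available, and it must jump over
  \<open>k\<close>.\<close>

lemma link_closed_of_size:
  assumes free: "G_free r k G" "k \<ge> 3" and G: "r_graph r G" "r \<ge> 2"
    and F: "F \<subseteq> G" "link_connected F" "card F \<ge> k"
  obtains X where "X \<subseteq> F" "link_connected X" "link_closed F X" "card X = k - 1"
proof -
  have G': "finite F" "\<forall>e\<in>F. finite e" "\<forall>e\<in>F. card e = r"
    using G F by (auto simp: r_graph_def finite_subset)
  let ?P = "\<lambda>X. X \<subseteq> F \<and> X \<noteq> {} \<and> link_connected X \<and> tight r X \<and> card X \<le> k - 1"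
  have notk: "card X \<noteq> k" if "X \<subseteq> F" "tight r X" for X
    using G_free_not_tight[OF free(1) G(1)] that F by blast
  obtain e where "e \<in> F" using F free by fastforce
  then have "?P {e}" using G' free G by (auto simp: link_connected_singleton tight_def)
  then have "\<exists>X. ?P X \<and> (\<forall>Y. ?P Y \<longrightarrow> X \<subseteq> Y \<longrightarrow> Y = X)"
    by (rule ex_maximal_subset[OF G'(1)]) simp
  then obtain X where max_X: "?P X \<and> (\<forall>Y. ?P Y \<longrightarrow> X \<subseteq> Y \<longrightarrow> Y = X)" ..
  note X = conjunct1[OF max_X] and max = conjunct2[OF max_X, rule_format]
  have finX: "finite X" "\<forall>e\<in>X. finite e" using X G' finite_subset by auto
  have closed: "link_closed F X"
    unfolding link_closed_def
  proof (intro ballI notI)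
    fix f g h assume a: "f \<in> F - X" "g \<in> X" "h \<in> X" "linked f g h"
    then have t: "tight r (insert f X)" using X G' finX G by (intro tight_insert[of r X f g h]) auto
    then have "card (insert f X) \<noteq> k" using notk a X by auto
    then have "card (insert f X) \<le> k - 1" using X a(1) finX(1) free(2) by auto
    then have "?P (insert f X)" using t X a link_connected_insert by auto
    then show False using max[of "insert f X"] a by blast
  qed
  have "X \<subset> F" "X \<noteq> {}" using X F free by auto
  with F(2) G'(2) have "card X = k - 1"
  proof (cases rule: link_connected_step)
    case (one f g h)
    then show ?thesis using closed by (auto simp: link_closed_def)
  next
    case (two f g h)
    let ?Y = "insert g (insert h X)"
    have t: "tight r ?Y" using two X G' finX G by (intro tight_insert2[of r X f g h]) auto
    then have "card ?Y \<noteq> k" using notk two X by auto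
    moreover have "card ?Y = card X + 2" using two finX by auto
    moreover have "\<not> card ?Y \<le> k - 1"
    proof
      assume "card ?Y \<le> k - 1"
      moreover have "link_connected ?Y" using two X G' by (intro link_connected_insert2[of _ f]) auto
      ultimately have "?P ?Y" using t X two by auto
      then show False using max[of ?Y] two by blast
    qed
    ultimately show ?thesis using X by linarith
  qed
  then show thesis using that X closed by blast
qed

text \<open>Since \<open>X\<close> may be much larger than \<open>k\<close>, the forbidden size is
  reached not from \<open>X\<close> but from a small tight set \<open>S\<close> around
  \<open>f\<close> inside \<open>X\<close>.\<close>

lemma link_closed_insert2:
  assumes free: "G_free r k G" and G: "r_graph r G" "r \<ge> 2" and F: "F \<subseteq> G"
    and X: "X \<subseteq> F" "link_connected X" "link_closed F X" "card X \<ge> k - 1"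
    and l: "f \<in> X" "g \<in> F - X" "h \<in> F - X" "g \<noteq> h" "linked f g h" and "k \<ge> 3"
  shows "link_closed F (insert g (insert h X))"
  unfolding link_closed_def
proof (intro ballI notI)
  fix f' g' h' assume a: "f' \<in> F - insert g (insert h X)" "g' \<in> insert g (insert h X)"
    "h' \<in> insert g (insert h X)" "linked f' g' h'"
  have G': "\<forall>e\<in>F. finite e" "\<forall>e\<in>F. card e = r" using G F by (auto simp: r_graph_def)
  have "r_graph r X" using G F X by (auto simp: r_graph_def finite_subset)
  \<comment> \<open>With \<open>g\<close>, \<open>h\<close> and \<open>f'\<close> a set of size
    \<open>k - 3\<close> grows to exactly \<open>k\<close> edges; for the other size,
    \<open>k - 2\<close>, already \<open>g\<close> and \<open>h\<close> lead to
    \<open>k\<close>.\<close>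
  then obtain S where S: "tight r S" "f \<in> S" "S \<subseteq> X" "card S = k - 3 \<or> card S = k - 3 + 1"
    using tight_subset_of_size[OF X(2) _ G(2) l(1), of "k - 3"] X(4)
    by (metis diff_le_mono2 le_trans numeral_le_iff one_le_numeral)
  have nS: "g \<notin> S" "h \<notin> S" using S l by auto
  let ?S' = "insert g (insert h S)"
  have finS: "finite S" "\<forall>e\<in>S. finite e" using S X G' by (auto simp: tight_def)
  have t: "tight r ?S'" using S l nS G' finS G X by (intro tight_insert2[of r S f g h]) auto
  have c: "card ?S' = card S + 2" using nS l finS by simp
  have notk: "card Y \<noteq> k" if "Y \<subseteq> F" "tight r Y" for Y
    using G_free_not_tight[OF free G(1)] that F by blast
  have "?S' \<subseteq> F" using S X l by blast
  from notk[OF this t] have "card S \<noteq> k - 3 + 1" using c \<open>k \<ge> 3\<close> by simp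
  then have c': "card S = k - 3" using S(4) by blast
  have closed: "\<not> linked a b c" if "a \<in> F - X" "b \<in> X" "c \<in> X" for a b c
    using X(3) that by (auto simp: link_closed_def)
  have adj: "\<not> 2 \<le> card (a \<inter> b)" if "a \<in> F - X" "b \<in> X" for a b
    using closed[OF that that(2)] linked_sameI that X G' by blast
  have "2 \<le> card (g' \<inter> h')" "2 \<le> card (h' \<inter> g')"
    using a(4) by (auto simp: linked_def Int_commute)
  \<comment> \<open>If both were in \<open>X\<close>, \<open>closed\<close> would be violated. If
    only one were, the other would be \<open>g\<close> or \<open>h\<close> and share two vertices
    with it, against \<open>adj\<close>.\<close>
  then have "g' \<notin> X" "h' \<notin> X"
    using a l adj[of g' h'] adj[of h' g'] closed[of f' g' h'] by auto
  then have "g' \<in> ?S'" "h' \<in> ?S'" using a by auto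
  moreover have f': "f' \<in> F" "f' \<notin> ?S'" using a(1) S(3) by auto
  moreover have "card f' = r" "finite f'" "\<forall>e\<in>?S'. finite e" using f'(1) l finS G' by auto
  ultimately have "tight r (insert f' ?S')"
    by (intro tight_insert[OF t a(4)] G)
  moreover have "card (insert f' ?S') = Suc (card ?S')"
    using f'(2) finS by (intro card_insert_disjoint) auto
  then have "card (insert f' ?S') = k" using c c' \<open>k \<ge> 3\<close> by linarith
  moreover have "insert f' ?S' \<subseteq> F" using \<open>?S' \<subseteq> F\<close> f'(1) by blast
  ultimately show False using notk by blast
qed

text \<open>Either kind of first step out of a singleton exhibits two distinct edges with two common
  vertices, so two edges of \<open>X\<close> have the same label.\<close>

lemma card_clusters_less:
  assumes X: "link_connected X" "\<forall>e\<in>X. finite e" "X \<subseteq> G" "card X \<ge> 2"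
  shows "card (cluster_of G ` X) < card X"
proof -
  have finX: "finite X" using X(4) card.infinite by fastforce
  obtain e where e: "e \<in> X" using X(4) by fastforce
  then have "{e} \<subset> X" "{e} \<noteq> {}" using X(4) by auto
  with X(1,2) have "\<exists>a\<in>X. \<exists>b\<in>X. a \<noteq> b \<and> 2 \<le> card (a \<inter> b)"
  proof (cases rule: link_connected_step)
    case (one f g h)
    then have "f \<in> X" "f \<noteq> e" "2 \<le> card (f \<inter> e)" by (auto simp: linked_def)
    then show ?thesis using e by blast
  next
    case (two f g h)
    then show ?thesis by (auto simp: linked_def)
  qed
  then have "\<not> inj_on (cluster_of G) X"
    using cluster_of_eq X(3) by (metis inj_onD subsetD)
  then show ?thesis using finX card_image_le[of X "cluster_of G"] inj_on_iff_eq_card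
    by fastforce
qed

theorem theorem3p7:
  fixes r k n :: nat
    and V :: "'a set"
    and G F :: "'a set set"
    and M2 :: "'a set set set"
  assumes "r \<ge> 3" and "k \<ge> 3"
    and "r_graph_on r V G" and "card V = n"
    and "G_free r k G"
    and "is_M2 r G M2"
    and "F \<in> M2"
    and "card F \<ge> k + 1"
  shows "int (card F) \<ge> 2 * int (merging_number G F) - int k + 3"
proof -
  have G: "r_graph r G" "r \<ge> 2" using assms by (auto simp: r_graph_on_def)
  note free = \<open>G_free r k G\<close>
  have F: "F \<subseteq> G" "link_connected F"
    using is_M2_link_connected[OF free \<open>k \<ge> 3\<close> G \<open>is_M2 r G M2\<close> \<open>F \<in> M2\<close>] by auto
  have fin: "finite F" "\<forall>e\<in>F. finite e" using F G by (auto simp: r_graph_def finite_subset)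
  let ?p = "\<lambda>X. card (cluster_of G ` X)"
  \<comment> \<open>The last conjunct is the claimed inequality for \<open>X\<close>, with labels in
    place of the merging number and rearranged to avoid subtraction.\<close>
  let ?P = "\<lambda>X. X \<subseteq> F \<and> link_connected X \<and> link_closed F X \<and> k - 1 \<le> card X
    \<and> 2 * ?p X + 3 \<le> card X + k"
  obtain X0 where X0: "X0 \<subseteq> F" "link_connected X0" "link_closed F X0" "card X0 = k - 1"
    using link_closed_of_size[OF free \<open>k \<ge> 3\<close> G F] assms by auto
  have "?p X0 < card X0"
    using X0 F fin \<open>k \<ge> 3\<close> by (intro card_clusters_less) auto
  \<comment> \<open>At most \<open>k - 2\<close> labels occur on \<open>X0\<close>, and
    \<open>2 * (k - 2) + 3 = (k - 1) + k\<close>.\<close>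
  then have "?P X0" using X0 by auto
  then have "\<exists>X. ?P X \<and> (\<forall>Y. ?P Y \<longrightarrow> X \<subseteq> Y \<longrightarrow> Y = X)"
    by (rule ex_maximal_subset[OF fin(1)]) simp
  then obtain X where max_X: "?P X \<and> (\<forall>Y. ?P Y \<longrightarrow> X \<subseteq> Y \<longrightarrow> Y = X)" ..
  note X = conjunct1[OF max_X] and max = conjunct2[OF max_X, rule_format]
  have "X = F"
  proof (rule ccontr)
    assume "X \<noteq> F"
    then have "X \<subset> F" "X \<noteq> {}" using X \<open>k \<ge> 3\<close> by auto
    with F(2) fin(2) show False
    proof (cases rule: link_connected_step)
      case (one f g h)
      then show ?thesis using X by (auto simp: link_closed_def)
    next
      case (two f g h)
      let ?Y = "insert g (insert h X)"
      have finX: "finite X" using X fin finite_subset by blast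
      \<comment> \<open>The pair brings at most one new label, so the left side of the invariant
        grows by at most 2 while the right side grows by exactly 2.\<close>
      have "cluster_of G g = cluster_of G h"
        using two F by (intro cluster_of_eq) (auto simp: linked_def)
      then have "?p ?Y \<le> Suc (?p X)" using finX by (simp add: card_insert_if)
      moreover have "card ?Y = card X + 2" using two finX by auto
      moreover have "link_connected ?Y" using two X fin by (intro link_connected_insert2[of _ f]) auto
      moreover have "link_closed F ?Y"
        using two X by (intro link_closed_insert2[OF free G F(1), of X f]) (use \<open>k \<ge> 3\<close> in auto)
      ultimately have "?P ?Y" using X two by auto
      then show ?thesis using max[of ?Y] two by blast
    qed
  qed
  then show ?thesis using X merging_number_le[OF fin(1), of G] by simp
qed

end
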